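(* Let $\lambda \in (0,\frac14)$, $x_* = \frac{1-\sqrt{1-4\lambda}}{2}$, $I_\lambda = \left(x_*, \frac{1+\sqrt{1-4\lambda}}{2}\right)$, and $\vec z \in I_\lambda \times (0,1)$. Let $T$ be a finite or countably infinite subset of $(x_*, \vec z_1) \times (0,1)$ such that for every $\vec v \in T \setminus \mathcal{A}(\vec z)$, the point $\mathit{Dec}(\vec v)$ is a convex combination of elements of $T$. Then $T \subseteq \mathcal{A}(\vec z)$.
   Context: For $\vec u \in \mathbb{R}^2$, $\vec u_1,\vec u_2$ denote its components. $\mathit{Inc}(\vec v) = \left(\frac{\lambda}{1-\vec v_1}, \frac{\vec v_2\,\lambda}{1-\vec v_1}\right)$, $\mathit{Dec}(\vec v) = \left(\frac{\vec v_1-\lambda}{\vec v_1}, \frac{\vec v_2}{\vec v_1}\right)$, and $\mathit{Inc}^n$ is the $n$-fold composition of $\mathit{Inc}$. The points $\mathit{Inc}^n(\vec z)$, $n \in \mathbb{N}$, have strictly decreasing first coordinates converging to $x_*$ and second coordinates converging to $0$. $\mathcal{A}(\vec z)$ is the closed convex region bounded by the vertical lines $x = x_*$ and $x = \vec z_1$, the horizontal line $y = 1$, and the polygonal chain consisting of the line segments between consecutive points $\mathit{Inc}^n(\vec z)$ and $\mathit{Inc}^{n+1}(\vec z)$ ($n \in \mathbb{N}$), ending at $(x_*,0)$; i.e. $\mathcal{A}(\vec z) = \{(x,y) : x_* \leq x \leq \vec z_1,\ g(x) \leq y \leq 1\}$ where $g$ is the piecewise-linear function on $[x_*,\vec z_1]$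 with $g(\mathit{Inc}^n(\vec z)_1) = \mathit{Inc}^n(\vec z)_2$ for all $n$, linear on each interval $[\mathit{Inc}^{n+1}(\vec z)_1, \mathit{Inc}^n(\vec z)_1]$, and $g(x_* ) = 0$. *)

theory Defs
  imports "HOL-Analysis.Analysis"
begin

definition Inc :: "real \<Rightarrow> real \<times> real \<Rightarrow> real \<times> real" where
  "Inc lam v = (lam / (1 - fst v), snd v * lam / (1 - fst v))"

definition Dec :: "real \<Rightarrow> real \<times> real \<Rightarrow> real \<times> real" where
  "Dec lam v = ((fst v - lam) / fst v, snd v / fst v)"

definition xstar :: "real \<Rightarrow> real" where
  "xstar lam = (1 - sqrt (1 - 4 * lam)) / 2"

definition I_lam :: "real \<Rightarrow> real set" where
  "I_lam lam = {xstar lam <..< (1 + sqrt (1 - 4 * lam)) / 2}"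

text \<open>
  The piecewise-linear function through the points \<open>(Inc lam ^^ n) z\<close>. The first coordinates of
  these points decrease strictly to \<open>xstar lam\<close>, so for \<open>xstar lam < x \<le> fst z\<close> the least \<open>n\<close> below
  is the index of the interval containing \<open>x\<close>. The lemmas \<open>chain_fun_xstar\<close>, \<open>chain_fun_Inc\<close> and
  \<open>chain_fun_linear\<close> state the properties that characterise the function on
  \<open>{xstar lam..fst z}\<close>.
\<close>

definition chain_fun :: "real \<Rightarrow> real \<times> real \<Rightarrow> real \<Rightarrow> real" where
  "chain_fun lam z x =
    (if x \<le> xstar lam then 0
     else let n = (LEAST n. fst ((Inc lam ^^ Suc n) z) \<le> x);
              p = (Inc lam ^^ Suc n) z;
              q = (Inc lam ^^ n) z
          in snd p + (x - fst p) / (fst q - fst p) * (snd q - snd p))"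

definition region_A :: "real \<Rightarrow> real \<times> real \<Rightarrow> (real \<times> real) set" where
  "region_A lam z =
    {(x, y). xstar lam \<le> x \<and> x \<le> fst z \<and> chain_fun lam z x \<le> y \<and> y \<le> 1}"

lemma I_lam_step:
  assumes "0 < lam" "lam < 1/4" "x \<in> I_lam lam"
  shows "lam / (1 - x) < x" "lam / (1 - x) \<in> I_lam lam"
proof -
  define s where "s = sqrt (1 - 4 * lam)"
  have s0: "s > 0" and s2: "s * s = 1 - 4 * lam" using assms by (auto simp: s_def)
  have "s * s < 1 * 1" using s2 assms by simp
  then have s1: "s < 1" using s0
    by (metis mult_strict_mono not_less_iff_gr_or_eq zero_less_one less_eq_real_def)
  have x: "(1 - s) / 2 < x" "x < (1 + s) / 2"
    using assms(3) by (auto simp: I_lam_def xstar_def s_def)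
  have x1: "x < 1" using x s1 by simp
  have "(x - (1 - s) / 2) * ((1 + s) / 2 - x) > 0" using x by simp
  moreover have "(x - (1 - s) / 2) * ((1 + s) / 2 - x) = x - x * x - (1 - s * s) / 4"
    by (simp add: field_simps)
  ultimately have "lam < x * (1 - x)" using s2 by (simp add: algebra_simps)
  then show lt: "lam / (1 - x) < x" using x1 by (simp add: pos_divide_less_eq)
  have "lam = (1 - s) / 2 * ((1 + s) / 2)" using s2 by (simp add: field_simps)
  moreover have "(1 - s) / 2 * (1 - x) < (1 - s) / 2 * ((1 + s) / 2)"
    by (rule mult_strict_left_mono) (use x s1 in \<open>simp_all add: field_simps\<close>)
  ultimately have "(1 - s) / 2 < lam / (1 - x)" using x1 by (simp add: pos_less_divide_eq)
  moreover have "lam / (1 - x) < (1 + s) / 2" using lt x(2) by (rule less_trans)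
  ultimately show "lam / (1 - x) \<in> I_lam lam"
    unfolding I_lam_def xstar_def s_def greaterThanLessThan_iff by blast
qed

lemma Inc_pow_fst_in_I_lam:
  assumes "0 < lam" "lam < 1/4" "fst z \<in> I_lam lam"
  shows "fst ((Inc lam ^^ n) z) \<in> I_lam lam"
  by (induction n) (use assms I_lam_step(2) in \<open>auto simp: Inc_def\<close>)

lemma Inc_pow_fst_strict_decreasing:
  assumes "0 < lam" "lam < 1/4" "fst z \<in> I_lam lam"
  shows "fst ((Inc lam ^^ Suc n) z) < fst ((Inc lam ^^ n) z)"
  using I_lam_step(1)[OF assms(1,2) Inc_pow_fst_in_I_lam[OF assms, of n]]
  by (simp add: Inc_def)

lemma Inc_pow_fst_decseq:
  assumes "0 < lam" "lam < 1/4" "fst z \<in> I_lam lam"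
  shows "decseq (\<lambda>n. fst ((Inc lam ^^ n) z))"
  by (rule decseq_SucI) (use Inc_pow_fst_strict_decreasing[OF assms] in \<open>auto intro: less_imp_le\<close>)

lemma Inc_pow_fst_tendsto:
  assumes "0 < lam" "lam < 1/4" "fst z \<in> I_lam lam"
  shows "(\<lambda>n. fst ((Inc lam ^^ n) z)) \<longlonglongrightarrow> xstar lam"
proof -
  let ?X = "\<lambda>n. fst ((Inc lam ^^ n) z)"
  define s where "s = sqrt (1 - 4 * lam)"
  have s0: "s > 0" and s2: "s * s = 1 - 4 * lam" using assms by (auto simp: s_def)
  have inI: "xstar lam < ?X n" "?X n < (1 + s) / 2" for n
    using Inc_pow_fst_in_I_lam[OF assms, of n] by (auto simp: I_lam_def s_def)
  obtain L where L: "?X \<longlonglongrightarrow> L" "\<And>n. L \<le> ?X n"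
    using decseq_convergent[OF Inc_pow_fst_decseq[OF assms], of "xstar lam"] inI
    by (metis less_imp_le)
  have L1: "xstar lam \<le> L" by (rule LIMSEQ_le_const[OF L(1)]) (use inI in \<open>auto intro: less_imp_le\<close>)
  have L2: "L < (1 + s) / 2" using L(2)[of 0] inI(2)[of 0] by simp
  have "s * s < 1 * 1" using s2 assms by simp
  then have "s < 1" using s0
    by (metis mult_strict_mono not_less_iff_gr_or_eq zero_less_one less_eq_real_def)
  then have "1 - L \<noteq> 0" using L2 by simp
  then have "(\<lambda>n. lam / (1 - ?X n)) \<longlonglongrightarrow> lam / (1 - L)"
    by (intro tendsto_intros L(1))
  then have "(\<lambda>n. ?X (Suc n)) \<longlonglongrightarrow> lam / (1 - L)" by (simp add: Inc_def)
  moreover have "(\<lambda>n. ?X (Suc n)) \<longlonglongrightarrow> L" by (rule LIMSEQ_Suc[OF L(1)])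
  ultimately have "lam / (1 - L) = L" by (rule LIMSEQ_unique)
  then have "lam = L * (1 - L)" using \<open>1 - L \<noteq> 0\<close> by (simp add: field_simps)
  moreover have "(L - (1 - s) / 2) * ((1 + s) / 2 - L) = L * (1 - L) - (1 - s * s) / 4"
    by (simp add: field_simps)
  ultimately have "(L - (1 - s) / 2) * ((1 + s) / 2 - L) = 0" using s2 by simp
  then have "L = xstar lam" using L2 by (auto simp: xstar_def s_def)
  then show ?thesis using L(1) by simp
qed

lemma Inc_pow_interval_exists:
  assumes "0 < lam" "lam < 1/4" "fst z \<in> I_lam lam" "xstar lam < x" "x \<le> fst z"
  shows "\<exists>n. x \<in> {fst ((Inc lam ^^ Suc n) z)..fst ((Inc lam ^^ n) z)}"
proof -
  let ?X = "\<lambda>n. fst ((Inc lam ^^ n) z)"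
  have "\<forall>\<^sub>F n in sequentially. ?X n < x"
    using order_tendstoD(2)[OF Inc_pow_fst_tendsto[OF assms(1-3)] assms(4)] .
  then obtain n where n: "?X n < x" by (auto simp: eventually_sequentially)
  define m where "m = (LEAST n. ?X n < x)"
  have m: "?X m < x" unfolding m_def by (rule LeastI[of "\<lambda>n. ?X n < x", OF n])
  then have "m \<noteq> 0" using assms(5) by (cases m) auto
  then obtain k where k: "m = Suc k" by (cases m) auto
  have "\<not> ?X k < x" using not_less_Least[of k "\<lambda>n. ?X n < x"] k by (simp add: m_def)
  then show ?thesis using m k by (intro exI[of _ k]) auto
qed

lemma chain_fun_xstar: "chain_fun lam z (xstar lam) = 0"
  by (simp add: chain_fun_def)

lemma chain_fun_linear:
  assumes "0 < lam" "lam < 1/4" "fst z \<in> I_lam lam"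
    and x: "x \<in> {fst ((Inc lam ^^ Suc n) z)..fst ((Inc lam ^^ n) z)}"
  defines "p \<equiv> (Inc lam ^^ Suc n) z" and "q \<equiv> (Inc lam ^^ n) z"
  shows "chain_fun lam z x = snd p + (x - fst p) / (fst q - fst p) * (snd q - snd p)"
proof -
  let ?P = "\<lambda>n. (Inc lam ^^ n) z"
  let ?m = "LEAST n. fst (?P (Suc n)) \<le> x"
  have xs: "\<not> x \<le> xstar lam"
    using x Inc_pow_fst_in_I_lam[OF assms(1-3), of "Suc n"] by (auto simp: I_lam_def)
  have Px: "fst (?P (Suc n)) \<le> x" using x by simp
  have m: "fst (?P (Suc ?m)) \<le> x" by (rule LeastI[of "\<lambda>n. fst (?P (Suc n)) \<le> x", OF Px])
  have mn: "?m \<le> n" by (rule Least_le[of "\<lambda>n. fst (?P (Suc n)) \<le> x", OF Px])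
  have eq: "chain_fun lam z x = snd (?P (Suc ?m)) + (x - fst (?P (Suc ?m))) /
      (fst (?P ?m) - fst (?P (Suc ?m))) * (snd (?P ?m) - snd (?P (Suc ?m)))"
    using xs unfolding chain_fun_def Let_def by (simp only: if_False)
  show ?thesis
  proof (cases "?m = n")
    case True
    show ?thesis using eq unfolding True p_def q_def .
  next
    case False
    then have "Suc ?m \<le> n" using mn by simp
    then have "fst (?P n) \<le> fst (?P (Suc ?m))"
      using Inc_pow_fst_decseq[OF assms(1-3)] by (auto simp: decseq_def simp del: funpow.simps)
    then have xq: "x = fst q" and xm: "fst (?P (Suc ?m)) = fst (?P n)"
      using m x unfolding q_def by auto
    have "Suc ?m = n"
    proof (rule ccontr)
      assume "Suc ?m \<noteq> n"
      then have "Suc (Suc ?m) \<le> n" using \<open>Suc ?m \<le> n\<close> by simp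
      then have "fst (?P n) \<le> fst (?P (Suc (Suc ?m)))"
        using Inc_pow_fst_decseq[OF assms(1-3)] by (auto simp: decseq_def simp del: funpow.simps)
      then show False
        using Inc_pow_fst_strict_decreasing[OF assms(1-3), of "Suc ?m"] xm by linarith
    qed
    then have "chain_fun lam z x = snd q"
      using eq xq by (simp only: q_def) simp
    moreover have "fst q - fst p \<noteq> 0"
      using Inc_pow_fst_strict_decreasing[OF assms(1-3), of n] unfolding p_def q_def by linarith
    ultimately show ?thesis using xq by simp
  qed
qed

lemma chain_fun_Inc:
  assumes "0 < lam" "lam < 1/4" "fst z \<in> I_lam lam"
  shows "chain_fun lam z (fst ((Inc lam ^^ n) z)) = snd ((Inc lam ^^ n) z)"
proof -
  have lt: "fst ((Inc lam ^^ Suc n) z) < fst ((Inc lam ^^ n) z)"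
    by (rule Inc_pow_fst_strict_decreasing[OF assms])
  then have "fst ((Inc lam ^^ n) z) \<in> {fst ((Inc lam ^^ Suc n) z)..fst ((Inc lam ^^ n) z)}"
    by simp
  from chain_fun_linear[OF assms this] lt show ?thesis by (simp del: funpow.simps)
qed

end

theory Submission
  imports Defs
begin

text \<open>
  Let \<open>a = xstar lam\<close> and \<open>b = 1 - a\<close> be the fixed points of \<open>Dec\<close> on the first coordinate. In the
  homogeneous coordinates \<open>b - x\<close>, \<open>x - a\<close>, \<open>y\<close> the projective map \<open>Dec\<close> is diagonal with entries
  \<open>a\<close>, \<open>b\<close>, \<open>1\<close>. Hence the line through \<open>Inc\<^sup>n z\<close> and \<open>Inc\<^sup>n\<^sup>+\<^sup>1 z\<close> has the closed form
  \<open>y = chain_line lam z (n + 2) x\<close>, and \<open>Dec\<close> carries the points below line \<open>i + 1\<close> to the points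
  below line \<open>i\<close>. On \<open>x \<le> fst z\<close> the chain is the upper envelope of the lines \<open>i \<ge> 1\<close>, so a point of
  \<open>T\<close> below line \<open>i + 1\<close> is outside the region, its image under \<open>Dec\<close> is a convex combination
  of points of \<open>T\<close>, and one of these is below line \<open>i\<close>. The descent ends at line \<open>0\<close>, which
  crosses the axis \<open>y = 0\<close> at \<open>x = fst z\<close> with positive slope; no point of \<open>T\<close> is below it.
\<close>

text \<open>Each fraction is 1 at \<open>fst z\<close>, so line \<open>0\<close> vanishes there; the
  leading factor makes lines \<open>1\<close> and \<open>2\<close> pass through
  \<open>z\<close>.\<close>

definition chain_line :: "real \<Rightarrow> real \<times> real \<Rightarrow> nat \<Rightarrow> real \<Rightarrow> real" where
  "chain_line lam z i x = snd z / (1 - 2 * xstar lam) *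
    ((1 - xstar lam) ^ i * ((x - xstar lam) / (fst z - xstar lam)) -
     xstar lam ^ i * ((1 - xstar lam - x) / (1 - xstar lam - fst z)))"

lemma xstar_bounds:
  assumes "0 < lam" "lam < 1/4"
  shows "0 < xstar lam" "xstar lam < 1/2"
  using assms by (auto simp: xstar_def)

lemma xstar_root:
  assumes "lam < 1/4"
  shows "xstar lam * (1 - xstar lam) = lam"
proof -
  define s where "s = sqrt (1 - 4 * lam)"
  have "s * s = 1 - 4 * lam" using assms by (auto simp: s_def)
  then show ?thesis by (simp add: xstar_def flip: s_def) (simp add: field_simps)
qed

lemma I_lam_eq: "I_lam lam = {xstar lam<..<1 - xstar lam}"
  by (auto simp: I_lam_def xstar_def field_simps)

text \<open>Both \<open>xstar lam\<close> and \<open>1 - xstar lam\<close> are roots of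
  \<open>t^2 = t - lam\<close>.\<close>

lemma chain_line_Suc_Suc:
  assumes "lam < 1/4"
  shows "chain_line lam z (Suc (Suc i)) x = chain_line lam z (Suc i) x - lam * chain_line lam z i x"
proof -
  define a where "a = xstar lam"
  have "a ^ Suc (Suc i) = a ^ Suc i - a * (1 - a) * a ^ i"
    "(1 - a) ^ Suc (Suc i) = (1 - a) ^ Suc i - a * (1 - a) * (1 - a) ^ i"
    by (simp_all add: algebra_simps)
  then show ?thesis
    unfolding chain_line_def a_def xstar_root[OF assms] by (simp only: ring_distribs mult_ac)
qed

text \<open>\<open>Dec\<close> multiplies \<open>x - xstar lam\<close> by
  \<open>(1 - xstar lam) / x\<close> and \<open>1 - xstar lam - x\<close> by
  \<open>xstar lam / x\<close>, so both exponents rise by one.\<close>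

lemma chain_line_Dec:
  assumes "lam < 1/4" "x \<noteq> 0"
  shows "chain_line lam z i ((x - lam) / x) = chain_line lam z (Suc i) x / x"
proof -
  define a where "a = xstar lam"
  have lam: "lam = a * (1 - a)" using xstar_root[OF assms(1)] by (simp add: a_def)
  have 1: "(x - lam) / x - a = (1 - a) * (x - a) / x"
    and 2: "1 - a - (x - lam) / x = a * (1 - a - x) / x"
    using assms(2) by (simp_all add: lam field_simps)
  have 3: "K * (B * (b * X / x / d) - A * (a * Y / x / e)) = K * (b * B * (X / d) - a * A * (Y / e)) / x"
    for K A B b X Y d e :: real
    by (simp add: right_diff_distrib diff_divide_distrib mult_ac)
  show ?thesis
    unfolding chain_line_def a_def[symmetric] 1 2 power_Suc by (rule 3)
qed

lemma chain_line_Inc: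
  assumes "0 < lam" "lam < 1/4" "x \<noteq> 1"
  shows "chain_line lam z (Suc i) (lam / (1 - x)) = chain_line lam z i x * lam / (1 - x)"
proof -
  have "(lam / (1 - x) - lam) / (lam / (1 - x)) = x" using assms by (simp add: field_simps)
  then show ?thesis
    using chain_line_Dec[of lam "lam / (1 - x)" z i] assms by simp
qed

lemma chain_line_mono:
  assumes "0 < lam" "lam < 1/4" "z \<in> I_lam lam \<times> {0<..<1}" "x \<le> x'"
  shows "chain_line lam z i x \<le> chain_line lam z i x'"
proof -
  have "xstar lam < fst z" "fst z < 1 - xstar lam" "0 < snd z"
    using assms(3) by (auto simp: I_lam_eq)
  then show ?thesis
    unfolding chain_line_def using xstar_bounds[OF assms(1,2)] assms(4)
    by (intro mult_left_mono diff_mono divide_right_mono) auto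
qed

lemma chain_line_affine:
  assumes "u + v = 1"
  shows "chain_line lam z i (u * x + v * x') = u * chain_line lam z i x + v * chain_line lam z i x'"
proof -
  have v: "v = 1 - u" using assms by simp
  have "u * x + v * x' - c = u * (x - c) + v * (x' - c)"
    "c - (u * x + v * x') = u * (c - x) + v * (c - x')" for c
    by (simp_all add: v algebra_simps)
  moreover have "K * (B * ((u * X + v * X') / d) - A * ((u * Y + v * Y') / e)) =
      u * (K * (B * (X / d) - A * (Y / e))) + v * (K * (B * (X' / d) - A * (Y' / e)))"
    for K A B X X' Y Y' d e :: real
    by (simp add: add_divide_distrib algebra_simps)
  ultimately show ?thesis unfolding chain_line_def by simp
qed

lemma convex_above_chain_line: "convex {v. chain_line lam z i (fst v) \<le> snd v}"
  by (auto intro!: convexI add_mono mult_left_mono simp: chain_line_affine)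

lemma chain_line_Inc_pow:
  assumes "0 < lam" "lam < 1/4" "z \<in> I_lam lam \<times> {0<..<1}"
  defines "X \<equiv> \<lambda>n. (Inc lam ^^ n) z"
  shows "chain_line lam z n (fst (X n)) = 0"
    and "chain_line lam z (Suc n) (fst (X n)) = snd (X n)"
    and "chain_line lam z (Suc (Suc n)) (fst (X n)) = snd (X n)"
proof -
  have z: "xstar lam < fst z" "fst z < 1 - xstar lam" "fst z \<in> I_lam lam"
    using assms(3) by (auto simp: I_lam_eq)
  have ne: "fst (X n) \<noteq> 1" for n
    using Inc_pow_fst_in_I_lam[OF assms(1,2) z(3), of n] xstar_bounds[OF assms(1,2)]
    by (auto simp: I_lam_eq X_def)
  show zero: "chain_line lam z n (fst (X n)) = 0"
  proof (induction n)
    case 0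
    show ?case using z by (simp add: X_def chain_line_def)
  next
    case (Suc n)
    then show ?case
      using chain_line_Inc[OF assms(1,2) ne, of z n n] by (simp add: X_def Inc_def)
  qed
  show one: "chain_line lam z (Suc n) (fst (X n)) = snd (X n)"
  proof (induction n)
    case 0
    show ?case using z xstar_bounds[OF assms(1,2)] by (simp add: X_def chain_line_def)
  next
    case (Suc n)
    then show ?case
      using chain_line_Inc[OF assms(1,2) ne, of z "Suc n" n] by (simp add: X_def Inc_def)
  qed
  \<comment> \<open>Since line \<open>n\<close> vanishes here, the recurrence makes the next two
    lines agree.\<close>
  show "chain_line lam z (Suc (Suc n)) (fst (X n)) = snd (X n)"
    using zero one chain_line_Suc_Suc[OF assms(2)] by simp
qed

text \<open>Both sides are affine on the interval and agree at its two ends.\<close>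

lemma chain_fun_eq_chain_line:
  assumes "0 < lam" "lam < 1/4" "z \<in> I_lam lam \<times> {0<..<1}"
    and x: "x \<in> {fst ((Inc lam ^^ Suc n) z)..fst ((Inc lam ^^ n) z)}"
  shows "chain_fun lam z x = chain_line lam z (Suc (Suc n)) x"
proof -
  have z: "fst z \<in> I_lam lam" using assms(3) by auto
  define p q where "p = (Inc lam ^^ Suc n) z" and "q = (Inc lam ^^ n) z"
  define t where "t = (x - fst p) / (fst q - fst p)"
  have "fst p < fst q"
    using Inc_pow_fst_strict_decreasing[OF assms(1,2) z, of n] unfolding p_def q_def .
  then have "t * (fst q - fst p) = x - fst p" by (simp add: t_def)
  then have "x = t * fst q + (1 - t) * fst p" by (simp add: algebra_simps)
  then have "chain_line lam z (Suc (Suc n)) x = t * snd q + (1 - t) * snd p"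
    using chain_line_Inc_pow(2)[OF assms(1-3), of "Suc n"]
      chain_line_Inc_pow(3)[OF assms(1-3), of n]
    by (simp only: chain_line_affine p_def q_def)
  also have "\<dots> = snd p + t * (snd q - snd p)" by (simp add: algebra_simps)
  finally show ?thesis
    using chain_fun_linear[OF assms(1,2) z x] unfolding p_def q_def t_def by simp
qed

text \<open>Line \<open>i + 2\<close> minus line \<open>i + 1\<close> is \<open>- lam\<close> times
  line \<open>i\<close>, whose sign depends on the side of its zero, the abscissa of
  \<open>Inc^i z\<close>. If \<open>x\<close> lies over segment \<open>n\<close>, the values thus
  rise up to index \<open>n + 2\<close> and fall afterwards.\<close>

lemma chain_line_le_chain_fun:
  assumes "0 < lam" "lam < 1/4" "z \<in> I_lam lam \<times> {0<..<1}" "xstar lam < x" "x \<le> fst z"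
  shows "chain_line lam z (Suc i) x \<le> chain_fun lam z x"
proof -
  let ?X = "\<lambda>n. fst ((Inc lam ^^ n) z)"
  let ?h = "\<lambda>i. chain_line lam z i x"
  have z: "fst z \<in> I_lam lam" using assms(3) by auto
  obtain n where n: "x \<in> {?X (Suc n)..?X n}"
    using Inc_pow_interval_exists[OF assms(1,2) z assms(4,5)] by blast
  have dec: "?X j \<le> ?X i" if "i \<le> j" for i j
    using Inc_pow_fst_decseq[OF assms(1,2) z] that by (auto simp: decseq_def)
  have up: "?h (Suc i) \<le> ?h (Suc (Suc i))" if "i \<le> n" for i
  proof -
    have "x \<le> ?X i" using n dec[OF that] by auto
    then have "?h i \<le> 0"
      using chain_line_mono[OF assms(1-3), of x "?X i" i] chain_line_Inc_pow(1)[OF assms(1-3), of i]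
      by simp
    then show ?thesis
      using assms(1) by (simp add: chain_line_Suc_Suc[OF assms(2)] mult_le_0_iff)
  qed
  have down: "?h (Suc (Suc i)) \<le> ?h (Suc i)" if "Suc n \<le> i" for i
  proof -
    have "?X i \<le> x" using n dec[OF that] by auto
    then have "0 \<le> ?h i"
      using chain_line_mono[OF assms(1-3), of "?X i" x i] chain_line_Inc_pow(1)[OF assms(1-3), of i]
      by simp
    then show ?thesis
      using assms(1) by (simp add: chain_line_Suc_Suc[OF assms(2)])
  qed
  have "?h (Suc i) \<le> ?h (Suc (Suc n))"
  proof (cases "i \<le> Suc n")
    case True
    then show ?thesis
    proof (induction i rule: inc_induct)
      case (step i)
      then show ?case using up[of i] by simp
    qed simp
  next
    case False
    then have "Suc n \<le> i" by simp
    then show ?thesis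
    proof (induction i rule: dec_induct)
      case (step i)
      then show ?case using down[of i] by simp
    qed simp
  qed
  then show ?thesis using chain_fun_eq_chain_line[OF assms(1-3) n] by simp
qed

text \<open>The descent becomes an induction on \<open>i\<close> over all of \<open>T\<close> at
  once, so that the hypothesis covers the whole convex hull.\<close>

lemma above_chain_line:
  assumes "0 < lam" "lam < 1/4" and z: "z \<in> I_lam lam \<times> {0<..<1}"
    and T: "T \<subseteq> {xstar lam<..<fst z} \<times> {0<..<1}"
    and Dec: "\<forall>v \<in> T - region_A lam z. Dec lam v \<in> convex hull T"
  shows "v \<in> T \<Longrightarrow> chain_line lam z i (fst v) \<le> snd v"
proof (induction i arbitrary: v)
  case 0
  then have "fst v \<le> fst z" "0 < snd v" using T by auto
  then show ?case
    using chain_line_mono[OF assms(1-3), of "fst v" "fst z" 0]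
      chain_line_Inc_pow(1)[OF assms(1-3), of 0] by simp
next
  case (Suc i)
  show ?case
  proof (rule ccontr)
    assume below: "\<not> chain_line lam z (Suc i) (fst v) \<le> snd v"
    have v: "xstar lam < fst v" "fst v \<le> fst z" using T Suc.prems by auto
    have pos: "0 < fst v" using v xstar_bounds[OF assms(1,2)] by simp
    have "v \<notin> region_A lam z"
      using below chain_line_le_chain_fun[OF assms(1-3) v, of i] by (auto simp: region_A_def)
    then have "Dec lam v \<in> convex hull T" using Dec Suc.prems by blast
    also have "convex hull T \<subseteq> {v. chain_line lam z i (fst v) \<le> snd v}"
      by (rule hull_minimal) (use Suc.IH in \<open>auto intro: convex_above_chain_line\<close>)
    \<comment> \<open>\<open>Dec\<close> divides the height and the value of the line by the same
      positive \<open>fst v\<close>.\<close>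
    finally have "chain_line lam z (Suc i) (fst v) / fst v \<le> snd v / fst v"
      using pos by (simp add: Dec_def chain_line_Dec[OF assms(2)])
    then show False using below pos by (simp add: divide_le_cancel)
  qed
qed

theorem theorem1:
  fixes lam :: real and z :: "real \<times> real" and T :: "(real \<times> real) set"
  assumes "0 < lam" and "lam < 1 / 4"
    and "z \<in> I_lam lam \<times> {0<..<1}"
    and "countable T"
    and "T \<subseteq> {xstar lam<..<fst z} \<times> {0<..<1}"
    and "\<forall>v \<in> T - region_A lam z. Dec lam v \<in> convex hull T"
  shows "T \<subseteq> region_A lam z"
proof
  fix v assume "v \<in> T"
  then have v: "xstar lam < fst v" "fst v \<le> fst z" "snd v \<le> 1" using assms(5) by auto
  have z: "fst z \<in> I_lam lam" using assms(3) by auto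
  obtain n where "fst v \<in> {fst ((Inc lam ^^ Suc n) z)..fst ((Inc lam ^^ n) z)}"
    using Inc_pow_interval_exists[OF assms(1,2) z v(1,2)] by blast
  \<comment> \<open>Only line \<open>n + 2\<close>, the chain over this interval, matters
    here.\<close>
  then have "chain_fun lam z (fst v) \<le> snd v"
    using above_chain_line[OF assms(1-3,5,6) \<open>v \<in> T\<close>] chain_fun_eq_chain_line[OF assms(1-3)]
    by simp
  then show "v \<in> region_A lam z" using v by (auto simp: region_A_def)
qed

end
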